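(* Let $X$ be a non-empty compact Hausdorff space with a countable base, let $\mathbf{I}$ be a completely codense ideal on $X$, and let $f:X\to X$ be a continuous map. If $f$ is $\mathbf{I}$-transitive, then $f$ has an $\mathbf{I}$-dense orbit.
   Context: $f^n$ is the $n$-th iterate of $f$. An ideal on $X$ is a nonempty collection $\mathbf{I}\subseteq 2^X$ closed under taking subsets and finite unions. A set $A\subseteq X$ is preopen if $A\subseteq Int(Cl(A))$; the ideal $\mathbf{I}$ is completely codense if the only preopen set belonging to $\mathbf{I}$ is $\varnothing$. $f$ is $\mathbf{I}$-transitive if for every pair of non-empty open sets $A,B\subseteq X$ there is a positive integer $n$ with $f^n(A)\cap B\notin\mathbf{I}$. For $A\subseteq X$, the local function is $A^*=\{x\in X: U\cap A\notin\mathbf{I}\text{ for every open }U\ni x\}$; $A$ is $\mathbf{I}$-dense if $A^*=X$. The orbit of $x\in X$ is $\{x,f(x),f^2(x),\dots\}$; $f$ has an $\mathbf{I}$-dense orbit if there is a point $x\in X$ whose orbit is $\mathbf{I}$-dense. *)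

theory Defs
  imports "HOL-Analysis.Analysis"
begin

(* The ideal of all subsets of S is not excluded. *)
definition set_ideal_on :: "'a set \<Rightarrow> 'a set set \<Rightarrow> bool" where
  "set_ideal_on S I \<longleftrightarrow>
     I \<subseteq> Pow S \<and> I \<noteq> {} \<and>
     (\<forall>A\<in>I. \<forall>B. B \<subseteq> A \<longrightarrow> B \<in> I) \<and>
     (\<forall>A\<in>I. \<forall>B\<in>I. A \<union> B \<in> I)"

definition preopen_in :: "'a topology \<Rightarrow> 'a set \<Rightarrow> bool" where
  "preopen_in X A \<longleftrightarrow>
     A \<subseteq> topspace X \<and> A \<subseteq> X interior_of (X closure_of A)"

definition completely_codense :: "'a topology \<Rightarrow> 'a set set \<Rightarrow> bool" where
  "completely_codense X I \<longleftrightarrow> {A \<in> I. preopen_in X A} = {{}}"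

definition ideal_transitive :: "'a topology \<Rightarrow> 'a set set \<Rightarrow> ('a \<Rightarrow> 'a) \<Rightarrow> bool" where
  "ideal_transitive X I f \<longleftrightarrow>
     (\<forall>A B. openin X A \<and> A \<noteq> {} \<and> openin X B \<and> B \<noteq> {} \<longrightarrow>
        (\<exists>n::nat. n > 0 \<and> (f ^^ n) ` A \<inter> B \<notin> I))"

definition local_function :: "'a topology \<Rightarrow> 'a set set \<Rightarrow> 'a set \<Rightarrow> 'a set" where
  "local_function X I A =
     {x \<in> topspace X. \<forall>U. openin X U \<and> x \<in> U \<longrightarrow> U \<inter> A \<notin> I}"

definition ideal_dense :: "'a topology \<Rightarrow> 'a set set \<Rightarrow> 'a set \<Rightarrow> bool" where
  "ideal_dense X I A \<longleftrightarrow> A \<subseteq> topspace X \<and> local_function X I A = topspace X"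

definition forward_orbit :: "('a \<Rightarrow> 'a) \<Rightarrow> 'a \<Rightarrow> 'a set" where
  "forward_orbit f x = range (\<lambda>n::nat. (f ^^ n) x)"

definition has_ideal_dense_orbit :: "'a topology \<Rightarrow> 'a set set \<Rightarrow> ('a \<Rightarrow> 'a) \<Rightarrow> bool" where
  "has_ideal_dense_orbit X I f \<longleftrightarrow>
     (\<exists>x\<in>topspace X. ideal_dense X I (forward_orbit f x))"

end

theory Submission
  imports Defs
begin

text \<open>
  Since the empty set lies in every ideal, \<open>I\<close>-transitivity implies ordinary topological
  transitivity, which in turn yields an ordinary dense orbit by Baire's theorem: the points
  whose orbit meets a given non-empty open set \<open>V\<close> form an open dense set, and running \<open>V\<close>
  through the non-empty members of a countable base leaves a dense intersection, all of whose
  points have a dense orbit (\<open>dense_orbit_if_transitive\<close>).  Complete codenseness closes the gap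
  between dense and \<open>I\<close>-dense: the trace of a dense set on a non-empty open set is non-empty and
  preopen, and so is not in \<open>I\<close> (\<open>ideal_dense_if_dense\<close>).
\<close>

text \<open>
  An open set lies in the closure of its trace on a dense set, and being open, it then lies in
  the interior of that closure.
\<close>

lemma preopen_in_open_Int_dense:
  assumes "D \<subseteq> topspace X" "X closure_of D = topspace X" "openin X U"
  shows "preopen_in X (U \<inter> D)"
proof -
  have "U \<subseteq> X closure_of (U \<inter> D)"
    using openin_Int_closure_of_subset[OF assms(3), of D] assms(2) openin_subset[OF assms(3)]
    by (metis Int_absorb2)
  then have "U \<subseteq> X interior_of (X closure_of (U \<inter> D))"
    by (rule interior_of_maximal[OF _ assms(3)])
  then show ?thesis
    using assms(1) unfolding preopen_in_def by fast
qed

lemma ideal_dense_if_dense: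
  assumes "completely_codense X I" "D \<subseteq> topspace X" "X closure_of D = topspace X"
  shows "ideal_dense X I D"
proof -
  have "U \<inter> D \<notin> I" if "openin X U" "x \<in> U" for U x
  proof
    assume "U \<inter> D \<in> I"
    with preopen_in_open_Int_dense[OF assms(2,3) that(1)]
    have "U \<inter> D \<in> {A \<in> I. preopen_in X A}"
      by simp
    with assms(1) have "U \<inter> D = {}"
      unfolding completely_codense_def by simp
    with assms(3) that show False
      unfolding dense_intersects_open by fast
  qed
  then have "local_function X I D = topspace X"
    unfolding local_function_def by auto
  with assms(2) show ?thesis
    unfolding ideal_dense_def by simp
qed

lemma continuous_map_funpow:
  "continuous_map X X f \<Longrightarrow> continuous_map X X (f ^^ n)"
proof (induction n)
  case 0
  then show ?case by simp
next
  case (Suc n)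
  then show ?case
    unfolding funpow.simps by (intro continuous_map_compose)
qed

lemma forward_orbit_subset_topspace:
  assumes "continuous_map X X f" "x \<in> topspace X"
  shows "forward_orbit f x \<subseteq> topspace X"
proof -
  have "(f ^^ n) x \<in> topspace X" for n
    using continuous_map_funpow[OF assms(1), of n] assms(2)
    by (simp add: continuous_map_def Pi_iff)
  then show ?thesis
    unfolding forward_orbit_def by auto
qed

text \<open>
  A point has a dense orbit iff it lies, for each non-empty basic open \<open>V\<close>, in the set
  \<open>hits V\<close> of points whose orbit meets \<open>V\<close>.  Continuity of the iterates makes \<open>hits V\<close> open,
  transitivity makes it dense, and there are only countably many \<open>V\<close>, so Baire's theorem
  applies; local compactness and regularity are assumed for its sake.
\<close>

lemma dense_orbit_if_transitive:
  assumes "topspace X \<noteq> {}"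
    and "locally_compact_space X" "regular_space X" "second_countable X"
    and cont: "continuous_map X X f"
    and trans: "\<And>A B. \<lbrakk>openin X A; A \<noteq> {}; openin X B; B \<noteq> {}\<rbrakk> \<Longrightarrow> \<exists>n::nat. (f ^^ n) ` A \<inter> B \<noteq> {}"
  shows "\<exists>x\<in>topspace X. X closure_of forward_orbit f x = topspace X"
proof -
  obtain \<B> where "countable \<B>" and open_\<B>: "\<forall>V\<in>\<B>. openin X V"
    and base: "\<forall>U x. openin X U \<and> x \<in> U \<longrightarrow> (\<exists>V\<in>\<B>. x \<in> V \<and> V \<subseteq> U)"
    using assms(4) unfolding second_countable_def by (elim exE conjE)
  define hits where "hits V = (\<Union>n. {x \<in> topspace X. (f ^^ n) x \<in> V})" for V
  have open_hits: "openin X (hits V)" if "openin X V" for V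
    unfolding hits_def
    using openin_continuous_map_preimage[OF continuous_map_funpow[OF cont] that]
    by (intro openin_Union) auto
  have dense_hits: "X closure_of hits V = topspace X" if V: "openin X V" "V \<noteq> {}" for V
    unfolding dense_intersects_open
  proof (intro allI impI, elim conjE)
    fix T assume T: "openin X T" "T \<noteq> {}"
    obtain n where "(f ^^ n) ` T \<inter> V \<noteq> {}"
      using trans[OF T V] ..
    then obtain x where "x \<in> T" "(f ^^ n) x \<in> V"
      by auto
    moreover have "x \<in> topspace X"
      using \<open>x \<in> T\<close> openin_subset[OF T(1)] by (rule subsetD[rotated])
    ultimately have "x \<in> hits V \<inter> T"
      unfolding hits_def by simp (rule exI)
    then show "hits V \<inter> T \<noteq> {}"
      by auto
  qed
  \<comment> \<open>The empty set may belong to the base, but no orbit meets it, so it is left out.\<close>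
  have "X closure_of \<Inter>(hits ` (\<B> - {{}})) = topspace X"
  proof (rule Baire_category)
    fix T assume "T \<in> hits ` (\<B> - {{}})"
    then show "openin X T \<and> X closure_of T = topspace X"
      using open_hits dense_hits open_\<B> by auto
  qed (use \<open>countable \<B>\<close> assms(2,3) in simp_all)
  then have "\<Inter>(hits ` (\<B> - {{}})) \<inter> topspace X \<noteq> {}"
    using assms(1) openin_topspace[of X] unfolding dense_intersects_open by simp
  then obtain x where x: "x \<in> topspace X" and hit: "\<forall>V\<in>\<B> - {{}}. x \<in> hits V"
    by auto
  have "X closure_of forward_orbit f x = topspace X"
    unfolding dense_intersects_open
  proof (intro allI impI, elim conjE)
    fix T assume T: "openin X T" "T \<noteq> {}"
    then obtain y where "y \<in> T"
      by auto
    with T(1) base obtain V where "V \<in> \<B>" "y \<in> V" "V \<subseteq> T"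
      by meson
    with hit have "x \<in> hits V"
      by auto
    then obtain n where "(f ^^ n) x \<in> V"
      unfolding hits_def by auto
    with \<open>V \<subseteq> T\<close> show "forward_orbit f x \<inter> T \<noteq> {}"
      unfolding forward_orbit_def by auto
  qed
  with x show ?thesis
    by (rule bexI[rotated])
qed

theorem proposition5p1:
  fixes X :: "'a topology" and I :: "'a set set" and f :: "'a \<Rightarrow> 'a"
  assumes "topspace X \<noteq> {}"
    and "compact_space X"
    and "Hausdorff_space X"
    and "second_countable X"
    and "set_ideal_on (topspace X) I"
    and "completely_codense X I"
    and "continuous_map X X f"
    and "ideal_transitive X I f"
  shows "has_ideal_dense_orbit X I f"
proof -
  obtain J where "J \<in> I"
    using assms(5) unfolding set_ideal_on_def by auto
  then have "{} \<in> I"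
    using assms(5) empty_subsetI[of J] unfolding set_ideal_on_def by simp
  then have trans: "\<exists>n::nat. (f ^^ n) ` A \<inter> B \<noteq> {}"
    if AB: "openin X A" "A \<noteq> {}" "openin X B" "B \<noteq> {}" for A B
  proof -
    obtain n :: nat where "(f ^^ n) ` A \<inter> B \<notin> I"
      using assms(8) AB unfolding ideal_transitive_def by meson
    with \<open>{} \<in> I\<close> have "(f ^^ n) ` A \<inter> B \<noteq> {}"
      by metis
    then show ?thesis ..
  qed
  obtain x where x: "x \<in> topspace X" "X closure_of forward_orbit f x = topspace X"
    using dense_orbit_if_transitive[OF assms(1) compact_imp_locally_compact_space[OF assms(2)]
        compact_Hausdorff_imp_regular_space[OF assms(2,3)] assms(4,7) trans]
    by blast
  then have "ideal_dense X I (forward_orbit f x)"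
    by (intro ideal_dense_if_dense assms(6) forward_orbit_subset_topspace assms(7))
  with x(1) show ?thesis
    unfolding has_ideal_dense_orbit_def by blast
qed

end
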